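(* Let $m \geq 3$ and $d\ge 1$ be integers and let $G_1=(C_m^d)_1$ be the graph defined in the context. Then there exists a vertex-spine of $G_1$ containing at most $2\pi\sqrt d\, m^{d-1}$ vertices.
   Context: $C_m$ denotes the cycle on the vertex set $M=\{1,2,\ldots,m\}$ (in this cyclic order). $G_1=(C_m^d)_1$ is the graph with vertex set $M^d$ in which two vertices $(i_1,\ldots,i_d)$ and $(j_1,\ldots,j_d)$ are adjacent iff they are equal in all coordinates but one, in which they are adjacent in $C_m$. A cycle in $G_1$ is called nontrivial if its projection along at least one of the coordinates contains the full cycle $C_m$. A vertex-spine is a set of vertices that intersects every nontrivial cycle. *)

theory Defs
  imports Complex_Main "HOL-Library.FuncSet"
begin

text \<open>The cycle \<open>C_m\<close> on \<open>{1..m}\<close>; the cyclic successor of \<open>i\<close> is \<open>i mod m + 1\<close>.\<close>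

definition Cm_adj :: "nat \<Rightarrow> nat \<Rightarrow> nat \<Rightarrow> bool" where
  "Cm_adj m i j \<longleftrightarrow> i \<in> {1..m} \<and> j \<in> {1..m} \<and> (j = i mod m + 1 \<or> i = j mod m + 1)"

definition Cm_edges :: "nat \<Rightarrow> nat set set" where
  "Cm_edges m = {{i, j} | i j. Cm_adj m i j}"

text \<open>The graph \<open>G_1 = (C_m^d)_1\<close>; a \<open>d\<close>-tuple over \<open>{1..m}\<close> is an extensional function on \<open>{1..d}\<close>.\<close>

definition G1_verts :: "nat \<Rightarrow> nat \<Rightarrow> (nat \<Rightarrow> nat) set" where
  "G1_verts m d = ({1..d} \<rightarrow>\<^sub>E {1..m})"

definition G1_adj :: "nat \<Rightarrow> nat \<Rightarrow> (nat \<Rightarrow> nat) \<Rightarrow> (nat \<Rightarrow> nat) \<Rightarrow> bool" where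
  "G1_adj m d x y \<longleftrightarrow> x \<in> G1_verts m d \<and> y \<in> G1_verts m d \<and>
     (\<exists>k\<in>{1..d}. Cm_adj m (x k) (y k) \<and> (\<forall>l\<in>{1..d} - {k}. x l = y l))"

text \<open>A (simple) cycle is given by the list of its vertices in cyclic order.\<close>

definition graph_cycle :: "'a set \<Rightarrow> ('a \<Rightarrow> 'a \<Rightarrow> bool) \<Rightarrow> 'a list \<Rightarrow> bool" where
  "graph_cycle V adj c \<longleftrightarrow> 3 \<le> length c \<and> distinct c \<and> set c \<subseteq> V \<and>
     (\<forall>i<length c. adj (c ! i) (c ! ((i + 1) mod length c)))"

definition cycle_edges :: "'a list \<Rightarrow> 'a set set" where
  "cycle_edges c = {{c ! i, c ! ((i + 1) mod length c)} | i. i < length c}"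

text \<open>The projection of a cycle along coordinate \<open>k\<close> is a subgraph of \<open>C_m\<close>, and it contains
  the full cycle when it has all vertices and all edges of \<open>C_m\<close>. An edge of the cycle in a
  direction other than \<open>k\<close> collapses to a singleton, which is not an edge of \<open>C_m\<close>.\<close>

definition nontrivial_cycle :: "nat \<Rightarrow> nat \<Rightarrow> (nat \<Rightarrow> nat) list \<Rightarrow> bool" where
  "nontrivial_cycle m d c \<longleftrightarrow> graph_cycle (G1_verts m d) (G1_adj m d) c \<and>
     (\<exists>k\<in>{1..d}. {1..m} \<subseteq> (\<lambda>x. x k) ` set c \<and>
        Cm_edges m \<subseteq> (\<lambda>e. (\<lambda>x. x k) ` e) ` cycle_edges c)"

definition vertex_spine :: "nat \<Rightarrow> nat \<Rightarrow> (nat \<Rightarrow> nat) set \<Rightarrow> bool" where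
  "vertex_spine m d S \<longleftrightarrow> S \<subseteq> G1_verts m d \<and>
     (\<forall>c. nontrivial_cycle m d c \<longrightarrow> S \<inter> set c \<noteq> {})"

end

theory Submission imports Defs "HOL-Analysis.Analysis" begin

text \<open>Suppose \<open>U\<close> and \<open>W\<close> are vertex sets such that \<open>W\<close> contains all neighbours of \<open>U\<close>, no vertex of
  \<open>U\<close> has a coordinate equal to \<open>m\<close>, and \<open>|W - U| \<le> \<epsilon> |W|\<close>. Averaging over all translations of
  the torus gives, for every set \<open>R\<close> of vertices not yet covered, a translate whose boundary part
  \<open>W - U\<close> meets \<open>R\<close> in at most an \<open>\<epsilon>\<close>-fraction of what \<open>W\<close> covers of \<open>R\<close>. Deleting these parts
  greedily removes at most \<open>\<epsilon> m\<^sup>d\<close> vertices, and every surviving cycle lies in one translate of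
  \<open>U\<close>, so each of its projections misses a vertex of \<open>C_m\<close>.

  Such sets with \<open>\<epsilon> = 2 \<pi> \<surd>d / m\<close> come from a vertex version of Cheeger's inequality. Let \<open>f\<close> be
  the product of the \<open>sin (\<pi> x\<^sub>i / m)\<close> and \<open>F x\<close> the maximum of \<open>f\<close> over the closed neighbourhood of
  \<open>x\<close>. The Dirichlet energy of \<open>f\<close> is \<open>2 d (1 - cos (\<pi> / m)) \<Sum> f\<^sup>2\<close>, and Cauchy-Schwarz applied to
  \<open>F\<^sup>2 - f\<^sup>2 = (F - f) (F + f)\<close> yields \<open>\<Sum> (F\<^sup>2 - f\<^sup>2) < \<epsilon> \<Sum> F\<^sup>2\<close>. Hence some level \<open>t\<close> makes
  \<open>U = {f\<^sup>2 > t}\<close> and \<open>W = {F\<^sup>2 > t}\<close> work.\<close>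

section \<open>Superlevel sets and the layer-cake formula\<close>

text \<open>The integrand differs from the indicator of \<open>{0..x}\<close> only at the single
  point \<open>x\<close>, which the integral ignores.\<close>

lemma has_integral_indicator_below:
  fixes x T :: real
  assumes "0 \<le> x" "x \<le> T"
  shows "((\<lambda>t. if t < x then 1 else 0 :: real) has_integral x) {0..T}"
proof -
  have "((\<lambda>t. 1 :: real) has_integral x) {0..x}"
    using has_integral_const_real[of "1::real" 0 x] assms by simp
  then have "((\<lambda>t. if t \<in> {0..x} then 1 else 0 :: real) has_integral x) {0..T}"
    using has_integral_restrict[of "{0..x}" "{0..T}" "\<lambda>t. 1::real" x] assms by auto
  then show ?thesis
    by (rule has_integral_spike_finite[where S = "{x}", rotated 2]) (use assms in auto)
qed

text \<open>Over the levels \<open>t\<close> in \<open>{0..T}\<close> the thresholded sum integrates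
  to the original one. If it were nonnegative at every level, so would be its integral; the weights
  may have either sign.\<close>

lemma exists_level_weighted_sum_neg:
  fixes w x :: "'i \<Rightarrow> real"
  assumes fin: "finite I" and nonneg: "\<And>i. i \<in> I \<Longrightarrow> 0 \<le> x i"
    and neg: "(\<Sum>i\<in>I. w i * x i) < 0"
  obtains t where "t \<ge> 0" "(\<Sum>i\<in>I. w i * (if t < x i then 1 else 0)) < 0"
proof -
  define T where "T = (\<Sum>i\<in>I. x i)"
  have T: "x i \<le> T" if "i \<in> I" for i
    unfolding T_def using that fin nonneg by (intro member_le_sum) auto
  have int: "((\<lambda>t. \<Sum>i\<in>I. w i * (if t < x i then 1 else 0)) has_integral (\<Sum>i\<in>I. w i * x i)) {0..T}"
    using fin nonneg T
    by (intro has_integral_sum has_integral_mult_right has_integral_indicator_below) auto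
  have "\<exists>t\<in>{0..T}. (\<Sum>i\<in>I. w i * (if t < x i then 1 else 0)) < 0"
  proof (rule ccontr)
    assume "\<not> ?thesis"
    then have "0 \<le> (\<Sum>i\<in>I. w i * x i)"
      using has_integral_nonneg[OF int] by (meson not_less)
    with neg show False by simp
  qed
  then show ?thesis using that by auto
qed

lemma exists_level_small_boundary:
  fixes g h :: "'a \<Rightarrow> real"
  assumes fin: "finite V" and gh: "\<And>x. x \<in> V \<Longrightarrow> 0 \<le> g x \<and> g x \<le> h x"
    and less: "(\<Sum>x\<in>V. h x - g x) < e * (\<Sum>x\<in>V. h x)"
  obtains t where "t \<ge> 0"
    "real (card {x \<in> V. t < h x \<and> \<not> t < g x}) < e * real (card {x \<in> V. t < h x})"
proof -
  \<comment> \<open>Two disjoint copies of \<open>V\<close> carry \<open>h\<close> and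
    \<open>g\<close>; with these weights the thresholded sum at level \<open>t\<close> is
    \<open>|{h > t}| - |{g > t}| - e |{h > t}|\<close>. As \<open>g \<le> h\<close>, the first
    difference counts \<open>{h > t} - {g > t}\<close>.\<close>
  define w where "w = (\<lambda>i::'a + 'a. case i of Inl _ \<Rightarrow> 1 - e | Inr _ \<Rightarrow> - 1)"
  define v where "v = case_sum h g"
  have split: "(\<Sum>i\<in>V <+> V. w i * u i)
      = (\<Sum>x\<in>V. u (Inl x) - u (Inr x)) - e * (\<Sum>x\<in>V. u (Inl x))" for u
    using fin by (simp add: sum.Plus w_def sum_subtractf sum_negf sum_distrib_left algebra_simps)
  have "(\<Sum>i\<in>V <+> V. w i * v i) < 0"
    using less by (simp add: split v_def)
  moreover have "0 \<le> v i" if "i \<in> V <+> V" for i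
    using that gh by (force simp: v_def)
  ultimately obtain t where t: "t \<ge> 0"
    "(\<Sum>i\<in>V <+> V. w i * (if t < v i then 1 else 0)) < 0"
    using exists_level_weighted_sum_neg[of "V <+> V" v w] fin by auto
  have "(\<Sum>x\<in>V. (if t < h x then 1 else 0) - (if t < g x then 1 else 0::real))
      = (\<Sum>x\<in>V. if t < h x \<and> \<not> t < g x then 1 else 0)"
    using gh by (intro sum.cong) force+
  also have "\<dots> = real (card {x \<in> V. t < h x \<and> \<not> t < g x})"
    using fin by (simp add: sum.If_cases Int_def)
  finally have "real (card {x \<in> V. t < h x \<and> \<not> t < g x}) < e * real (card {x \<in> V. t < h x})"
    using t(2) fin unfolding split by (simp add: v_def sum.If_cases Int_def)
  with t(1) show ?thesis by (rule that)
qed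

section \<open>Averaging over a cover and greedy deletion\<close>

text \<open>Membership in \<open>A\<close> is passed on from each vertex to its successor, and going
  once around from a vertex in \<open>A\<close> reaches the whole cycle.\<close>

lemma graph_cycle_subset_if_closed:
  assumes cyc: "graph_cycle V adj c" and x: "x \<in> set c" "x \<in> A"
    and closed: "\<And>x y. x \<in> set c \<Longrightarrow> y \<in> set c \<Longrightarrow> adj x y \<Longrightarrow> x \<in> A \<Longrightarrow> y \<in> A"
  shows "set c \<subseteq> A"
proof -
  let ?n = "length c"
  from x obtain i where i: "i < ?n" "c ! i \<in> A" by (auto simp: in_set_conv_nth)
  have n: "?n > 0" and adj: "\<And>j. j < ?n \<Longrightarrow> adj (c ! j) (c ! ((j + 1) mod ?n))"
    using cyc by (auto simp: graph_cycle_def)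
  have step: "c ! ((i + k) mod ?n) \<in> A" for k
  proof (induction k)
    case 0
    then show ?case using i by simp
  next
    case (Suc k)
    have "((i + k) mod ?n + 1) mod ?n = (i + Suc k) mod ?n" by (simp add: mod_Suc_eq)
    then show ?case
      using closed[OF _ _ adj[of "(i + k) mod ?n"] Suc] n by simp
  qed
  show ?thesis
  proof
    fix y assume "y \<in> set c"
    then obtain j where j: "j < ?n" "y = c ! j" by (auto simp: in_set_conv_nth)
    have "(i + (?n - i + j)) mod ?n = j" using i j by simp
    then show "y \<in> A" using step[of "?n - i + j"] j by simp
  qed
qed

text \<open>Double counting the pairs of a point of \<open>R\<close> and a member containing it
  turns the pointwise ratios into an inequality between sums over \<open>I\<close>, so some member
  satisfies it. That this member meets \<open>R\<close> guarantees progress of the greedy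
  deletion.\<close>

lemma exists_member_small_boundary:
  fixes e :: real
  assumes fin: "finite I" "finite R" and "R \<noteq> {}"
    and cover: "\<And>x. x \<in> R \<Longrightarrow> \<exists>s\<in>I. x \<in> B s"
    and ratio: "\<And>x. x \<in> R \<Longrightarrow> real (card {s \<in> I. x \<in> B s - A s}) \<le> e * real (card {s \<in> I. x \<in> B s})"
  obtains s where "s \<in> I" "R \<inter> B s \<noteq> {}"
    "real (card (R \<inter> (B s - A s))) \<le> e * real (card (R \<inter> B s))"
proof -
  have double: "(\<Sum>s\<in>I. real (card (R \<inter> C s))) = (\<Sum>x\<in>R. real (card {s \<in> I. x \<in> C s}))" for C
  proof -
    have "(\<Sum>s\<in>I. real (card (R \<inter> C s))) = (\<Sum>s\<in>I. \<Sum>x\<in>R. if x \<in> C s then 1 else 0)"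
      using fin by (simp add: sum.If_cases)
    also have "\<dots> = (\<Sum>x\<in>R. \<Sum>s\<in>I. if x \<in> C s then 1 else 0)" by (rule sum.swap)
    also have "\<dots> = (\<Sum>x\<in>R. real (card {s \<in> I. x \<in> C s}))"
      using fin by (simp add: sum.If_cases Int_def)
    finally show ?thesis .
  qed
  have le: "(\<Sum>s\<in>I. real (card (R \<inter> (B s - A s)))) \<le> (\<Sum>s\<in>I. e * real (card (R \<inter> B s)))"
    unfolding sum_distrib_left[symmetric] double[of "\<lambda>s. B s - A s"] double[of B]
    using ratio by (simp add: sum_distrib_left sum_mono)
  have "\<exists>s\<in>I. R \<inter> B s \<noteq> {} \<and> real (card (R \<inter> (B s - A s))) \<le> e * real (card (R \<inter> B s))"
  proof (rule ccontr)
    assume neg: "\<not> ?thesis"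
    \<comment> \<open>A member disjoint from \<open>R\<close> contributes 0 to both sides; every
      other one violates the bound by assumption.\<close>
    have weak: "e * real (card (R \<inter> B s)) \<le> real (card (R \<inter> (B s - A s)))" if "s \<in> I" for s
      using neg that by (cases "R \<inter> B s = {}") force+
    obtain s where s: "s \<in> I" "R \<inter> B s \<noteq> {}" using cover \<open>R \<noteq> {}\<close> by blast
    have "(\<Sum>s\<in>I. e * real (card (R \<inter> B s))) < (\<Sum>s\<in>I. real (card (R \<inter> (B s - A s))))"
      using weak s neg fin by (intro sum_strict_mono_ex1) (auto simp: not_le)
    with le show False by simp
  qed
  then show ?thesis using that by blast
qed

text \<open>Pick a good member \<open>s\<close>, delete \<open>R \<inter> (B s - A s)\<close> and
  recurse on \<open>R - B s\<close>. A surviving cycle that meets \<open>A s\<close> cannot leave it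
  without entering the deleted boundary; one that misses \<open>A s\<close> misses all of
  \<open>B s\<close> and falls to the recursion.\<close>

lemma exists_cycle_localizing_set:
  fixes e :: real
  assumes fin: "finite I" "finite R"
    and cover: "\<And>x. x \<in> R \<Longrightarrow> \<exists>s\<in>I. x \<in> B s"
    and ratio: "\<And>x. x \<in> R \<Longrightarrow> real (card {s \<in> I. x \<in> B s - A s}) \<le> e * real (card {s \<in> I. x \<in> B s})"
    and nbhd: "\<And>s x y. s \<in> I \<Longrightarrow> x \<in> A s \<Longrightarrow> adj x y \<Longrightarrow> y \<in> B s"
  shows "\<exists>S\<subseteq>R. real (card S) \<le> e * real (card R) \<and>
    (\<forall>c. graph_cycle V adj c \<and> set c \<subseteq> R - S \<longrightarrow> (\<exists>s\<in>I. set c \<subseteq> A s))"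
  using fin(2) cover ratio
proof (induction R rule: finite_psubset_induct)
  case (psubset R)
  show ?case
  proof (cases "R = {}")
    case True
    then show ?thesis by (intro exI[of _ "{}"]) (auto simp: graph_cycle_def)
  next
    case False
    obtain s where s: "s \<in> I" "R \<inter> B s \<noteq> {}"
      "real (card (R \<inter> (B s - A s))) \<le> e * real (card (R \<inter> B s))"
      using exists_member_small_boundary[OF fin(1) psubset.hyps False psubset.prems] by blast
    \<comment> \<open>Cover and ratio are pointwise conditions, so they pass to
      \<open>R - B s\<close>, which is a proper subset since \<open>B s\<close> meets
      \<open>R\<close>.\<close>
    have "\<exists>S\<subseteq>R - B s. real (card S) \<le> e * real (card (R - B s)) \<and>
      (\<forall>c. graph_cycle V adj c \<and> set c \<subseteq> R - B s - S \<longrightarrow> (\<exists>s\<in>I. set c \<subseteq> A s))"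
      using s psubset.prems by (intro psubset.IH) auto
    then obtain S where S: "S \<subseteq> R - B s" "real (card S) \<le> e * real (card (R - B s))"
      and cyc: "\<And>c. graph_cycle V adj c \<Longrightarrow> set c \<subseteq> R - B s - S \<Longrightarrow> \<exists>s\<in>I. set c \<subseteq> A s"
      by blast
    let ?S = "S \<union> (R \<inter> (B s - A s))"
    have "real (card ?S) \<le> real (card S) + real (card (R \<inter> (B s - A s)))"
      using card_Un_le[of S "R \<inter> (B s - A s)"] by linarith
    also have "\<dots> \<le> e * (real (card (R - B s)) + real (card (R \<inter> B s)))"
      using S s by (simp add: distrib_left)
    also have "real (card (R - B s)) + real (card (R \<inter> B s)) = real (card R)"
      using card_Int_Diff[OF psubset.hyps, of "B s"] by simp
    finally have "real (card ?S) \<le> e * real (card R)" .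
    moreover have "\<exists>s\<in>I. set c \<subseteq> A s" if c: "graph_cycle V adj c" "set c \<subseteq> R - ?S" for c
    proof (cases "set c \<inter> A s = {}")
      case True
      then have "set c \<subseteq> R - B s - S" using c(2) by blast
      then show ?thesis using cyc c(1) by blast
    next
      case False
      then obtain x where "x \<in> set c" "x \<in> A s" by blast
      moreover have "y \<in> A s" if "x \<in> set c" "y \<in> set c" "adj x y" "x \<in> A s" for x y
        using nbhd[OF s(1) that(4,3)] c(2) that(2) by blast
      ultimately have "set c \<subseteq> A s" by (rule graph_cycle_subset_if_closed[OF c(1)])
      then show ?thesis using s(1) by blast
    qed
    ultimately show ?thesis using S(1) by (intro exI[of _ ?S]) auto
  qed
qed

section \<open>Neighbours and translations in the discrete torus\<close>

definition cyc_pred :: "nat \<Rightarrow> nat \<Rightarrow> nat" where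
  "cyc_pred m i = (if i = 1 then m else i - 1)"

definition up :: "nat \<Rightarrow> nat \<Rightarrow> (nat \<Rightarrow> nat) \<Rightarrow> nat \<Rightarrow> nat" where
  "up m k x = x(k := x k mod m + 1)"

definition down :: "nat \<Rightarrow> nat \<Rightarrow> (nat \<Rightarrow> nat) \<Rightarrow> nat \<Rightarrow> nat" where
  "down m k x = x(k := cyc_pred m (x k))"

definition closed_nbhd :: "nat \<Rightarrow> nat \<Rightarrow> (nat \<Rightarrow> nat) \<Rightarrow> (nat \<Rightarrow> nat) set" where
  "closed_nbhd m d x = insert x ((\<lambda>k. up m k x) ` {1..d} \<union> (\<lambda>k. down m k x) ` {1..d})"

text \<open>Modulo \<open>m\<close> this is translation by \<open>s i + 1\<close>: the final
  \<open>+ 1\<close> brings remainders back to \<open>{1..m}\<close>. The offset is harmless because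
  \<open>s\<close> runs over all vertices.\<close>

definition shift :: "nat \<Rightarrow> nat \<Rightarrow> (nat \<Rightarrow> nat) \<Rightarrow> (nat \<Rightarrow> nat) \<Rightarrow> nat \<Rightarrow> nat" where
  "shift m d s x = (\<lambda>i\<in>{1..d}. (x i + s i) mod m + 1)"

text \<open>The first Dirichlet eigenfunction of the torus cut open where some coordinate equals
  \<open>m\<close>: it vanishes there and is positive at all other vertices.\<close>

definition sine_prod :: "nat \<Rightarrow> nat \<Rightarrow> (nat \<Rightarrow> nat) \<Rightarrow> real" where
  "sine_prod m d x = (\<Prod>i\<in>{1..d}. sin (pi * real (x i) / real m))"

definition sine_max :: "nat \<Rightarrow> nat \<Rightarrow> (nat \<Rightarrow> nat) \<Rightarrow> real" where
  "sine_max m d x = Max (sine_prod m d ` closed_nbhd m d x)"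

lemma finite_G1_verts: "finite (G1_verts m d)"
  by (simp add: G1_verts_def finite_PiE)

lemma card_G1_verts: "card (G1_verts m d) = m ^ d"
  by (simp add: G1_verts_def card_PiE)

lemma cyc_succ_mem: "(m::nat) \<ge> 1 \<Longrightarrow> i mod m + 1 \<in> {1..m}"
  using mod_less_divisor[of m i] by (simp add: Suc_leI)

lemma cyc_pred_mem: "i \<in> {1..m} \<Longrightarrow> cyc_pred m i \<in> {1..m}"
  by (auto simp: cyc_pred_def)

lemma cyc_pred_succ: "i \<in> {1..m} \<Longrightarrow> cyc_pred m (i mod m + 1) = i"
  by (cases "i = m") (auto simp: cyc_pred_def)

lemma cyc_succ_pred: "i \<in> {1..m} \<Longrightarrow> cyc_pred m i mod m + 1 = i"
  by (auto simp: cyc_pred_def)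

lemma G1_verts_upd: "x \<in> G1_verts m d \<Longrightarrow> k \<in> {1..d} \<Longrightarrow> j \<in> {1..m} \<Longrightarrow> x(k := j) \<in> G1_verts m d"
  by (auto simp: G1_verts_def PiE_def Pi_def extensional_def)

lemma G1_verts_coord: "x \<in> G1_verts m d \<Longrightarrow> k \<in> {1..d} \<Longrightarrow> x k \<in> {1..m}"
  by (auto simp: G1_verts_def)

lemma up_mem: "m \<ge> 1 \<Longrightarrow> x \<in> G1_verts m d \<Longrightarrow> k \<in> {1..d} \<Longrightarrow> up m k x \<in> G1_verts m d"
  unfolding up_def by (intro G1_verts_upd cyc_succ_mem)

lemma down_mem: "x \<in> G1_verts m d \<Longrightarrow> k \<in> {1..d} \<Longrightarrow> down m k x \<in> G1_verts m d"
  unfolding down_def by (rule G1_verts_upd[OF _ _ cyc_pred_mem[OF G1_verts_coord]])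

lemma down_up: "x \<in> G1_verts m d \<Longrightarrow> k \<in> {1..d} \<Longrightarrow> down m k (up m k x) = x"
  using cyc_pred_succ[of "x k" m] G1_verts_coord[of x m d k] by (simp add: up_def down_def)

lemma up_down: "x \<in> G1_verts m d \<Longrightarrow> k \<in> {1..d} \<Longrightarrow> up m k (down m k x) = x"
  using cyc_succ_pred[of "x k" m] G1_verts_coord[of x m d k] by (simp add: up_def down_def)

lemma G1_adj_closed_nbhd:
  assumes "G1_adj m d x y"
  shows "x \<in> closed_nbhd m d y"
proof -
  from assms obtain k where k: "k \<in> {1..d}" and adj: "Cm_adj m (x k) (y k)"
    and eq: "\<forall>l\<in>{1..d} - {k}. x l = y l" and V: "x \<in> G1_verts m d" "y \<in> G1_verts m d"
    by (auto simp: G1_adj_def)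
  have "x l = y l" if "l \<noteq> k" for l
    using V eq that by (cases "l \<in> {1..d}") (auto simp: G1_verts_def PiE_def extensional_def)
  then have x: "x = y(k := x k)" by auto
  from adj consider "x k = y k mod m + 1" | "x k = cyc_pred m (y k)"
    using cyc_pred_succ[of "x k" m] by (auto simp: Cm_adj_def)
  then have "x = up m k y \<or> x = down m k y"
    by cases (use x in \<open>simp_all add: up_def down_def\<close>)
  then show ?thesis using k by (auto simp: closed_nbhd_def)
qed

lemma shift_mem: "m \<ge> 1 \<Longrightarrow> shift m d s x \<in> G1_verts m d"
  unfolding shift_def G1_verts_def by (intro restrict_PiE_iff[THEN iffD2] ballI cyc_succ_mem)

lemma inj_on_shift:
  "inj_on (\<lambda>s. shift m d s x) (G1_verts m d)"
proof (rule inj_onI)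
  fix s s' assume V: "s \<in> G1_verts m d" "s' \<in> G1_verts m d" and eq: "shift m d s x = shift m d s' x"
  have "s i = s' i" if i: "i \<in> {1..d}" for i
  proof -
    have "(x i + s i) mod m = (x i + s' i) mod m"
      using fun_cong[OF eq, of i] i by (simp add: shift_def)
    then have "s i mod m = s' i mod m"
      by (auto simp: nat_mod_eq_iff)
    then show ?thesis
      using cyc_pred_succ[OF G1_verts_coord[OF V(1) i]] cyc_pred_succ[OF G1_verts_coord[OF V(2) i]] by simp
  qed
  then show "s = s'" using V unfolding G1_verts_def by (intro PiE_ext) auto
qed

text \<open>For a fixed point, the map from translations to images is an injective self-map of the
  finite vertex set, hence a bijection. The count is therefore independent of \<open>x\<close>,
  which is what averaging requires.\<close>

lemma card_shift_preimage:
  assumes "m \<ge> 1" "C \<subseteq> G1_verts m d"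
  shows "card {s \<in> G1_verts m d. shift m d s x \<in> C} = card C"
proof -
  have "(\<lambda>s. shift m d s x) ` G1_verts m d = G1_verts m d"
    using shift_mem[OF assms(1)] inj_on_shift finite_G1_verts
    by (intro endo_inj_surj) auto
  then have "bij_betw (\<lambda>s. shift m d s x) {s \<in> G1_verts m d. shift m d s x \<in> C} C"
    using assms(2) inj_on_subset[OF inj_on_shift[of m d x]] by (auto simp: bij_betw_def)
  then show ?thesis by (rule bij_betw_same_card)
qed

lemma Cm_adj_shift:
  assumes "m \<ge> 1" "Cm_adj m i j"
  shows "Cm_adj m ((i + a) mod m + 1) ((j + a) mod m + 1)"
proof -
  \<comment> \<open>Translation commutes with the cyclic successor.\<close>
  have "((i mod m + 1) + a) mod m = ((i + a) mod m + 1) mod m" for i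
    by (metis add.assoc add.commute mod_add_left_eq)
  then show ?thesis using assms(2) cyc_succ_mem[OF assms(1)] unfolding Cm_adj_def by metis
qed

lemma G1_adj_shift:
  assumes "m \<ge> 1" "G1_adj m d x y"
  shows "G1_adj m d (shift m d s x) (shift m d s y)"
proof -
  from assms obtain k where k: "k \<in> {1..d}" "Cm_adj m (x k) (y k)" "\<forall>l\<in>{1..d} - {k}. x l = y l"
    by (auto simp: G1_adj_def)
  then have "Cm_adj m (shift m d s x k) (shift m d s y k)"
    "\<forall>l\<in>{1..d} - {k}. shift m d s x l = shift m d s y l"
    using Cm_adj_shift[OF assms(1) k(2)] by (auto simp: shift_def)
  then show ?thesis using k(1) shift_mem[OF assms(1)] by (auto simp: G1_adj_def)
qed

section \<open>Dirichlet energy of the sine product\<close>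

text \<open>Summation by parts combined with the eigenvalue recurrence
  \<open>s (j + 2) + s j = 2 cos \<theta> s (j + 1)\<close>.\<close>

lemma sine_energy_one_dim:
  assumes "m \<ge> 1"
  shows "(\<Sum>j\<in>{1..m}. (sin (pi * real (j mod m + 1) / real m) - sin (pi * real j / real m))\<^sup>2)
    = 2 * (1 - cos (pi / real m)) * (\<Sum>j\<in>{1..m}. (sin (pi * real j / real m))\<^sup>2)"
proof -
  define \<theta> where "\<theta> = pi / real m"
  define s where "s = (\<lambda>j. sin (real j * \<theta>))"
  have sm: "s m = 0" "s 0 = 0" using assms by (simp_all add: s_def \<theta>_def)
  have s_Suc: "s (Suc j) = s j * cos \<theta> + cos (real j * \<theta>) * sin \<theta>" for j
    by (simp add: s_def distrib_right sin_add algebra_simps)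
  have rec: "s (Suc (Suc j)) + s j = 2 * cos \<theta> * s (Suc j)" for j
  proof -
    have "s (Suc (Suc j)) = sin (real (Suc j) * \<theta> + \<theta>)" "s j = sin (real (Suc j) * \<theta> - \<theta>)"
      by (simp_all add: s_def algebra_simps)
    then show ?thesis unfolding sin_add sin_diff by (simp add: s_def)
  qed
  have shift: "(\<Sum>j\<in>{1..m}. g j) = (\<Sum>j<m. g (Suc j))" for g :: "nat \<Rightarrow> real"
    by (simp add: sum.atLeast1_atMost_eq)
  have rotate_back: "(\<Sum>j<m. g (Suc j)) = (\<Sum>j<m. g j)" if "g m = g 0" for g :: "nat \<Rightarrow> real"
    using sum.lessThan_Suc_shift[of g m] that by simp
  \<comment> \<open>The sine changes sign after one turn, but as \<open>s m = 0\<close> the square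
    of the difference along the wrap-around edge is unaffected.\<close>
  have "s (Suc m) = - s 1"
    using s_Suc[of m] s_Suc[of 0] sm assms by (simp add: \<theta>_def)
  then have sq: "(s (j mod m + 1) - s j)\<^sup>2 = (s (Suc j) - s j)\<^sup>2" if "j \<in> {1..m}" for j
    using that sm by (cases "j = m") auto
  have "(\<Sum>j\<in>{1..m}. (s (j mod m + 1) - s j)\<^sup>2) = (\<Sum>j\<in>{1..m}. (s (Suc j) - s j)\<^sup>2)"
    using sq by (rule sum.cong[OF refl])
  also have "\<dots> = (\<Sum>j<m. (s (Suc j) - s j)\<^sup>2)"
    using \<open>s (Suc m) = - s 1\<close> sm unfolding shift by (intro rotate_back) simp
  also have "\<dots> = (\<Sum>j<m. (s (Suc j))\<^sup>2) + (\<Sum>j<m. (s j)\<^sup>2) - (\<Sum>j<m. s (Suc j) * s j) - (\<Sum>j<m. s (Suc j) * s j)"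
    by (simp add: power2_diff sum.distrib sum_subtractf mult.assoc flip: sum_distrib_left)
  also have "(\<Sum>j<m. (s j)\<^sup>2) = (\<Sum>j<m. (s (Suc j))\<^sup>2)"
    by (rule rotate_back[symmetric]) (simp add: sm)
  \<comment> \<open>One of the two equal cross sums is moved by one index, so that
    \<open>rec\<close> applies to their sum; the end terms vanish because
    \<open>s 0 = s m = 0\<close>.\<close>
  also have "(\<Sum>j<m. (s (Suc j))\<^sup>2) + (\<Sum>j<m. (s (Suc j))\<^sup>2) - (\<Sum>j<m. s (Suc j) * s j) - (\<Sum>j<m. s (Suc j) * s j)
     = 2 * (\<Sum>j<m. (s (Suc j))\<^sup>2) - ((\<Sum>j<m. s (Suc (Suc j)) * s (Suc j)) + (\<Sum>j<m. s (Suc j) * s j))"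
    using rotate_back[of "\<lambda>j. s (Suc j) * s j"] sm by simp
  also have "(\<Sum>j<m. s (Suc (Suc j)) * s (Suc j)) + (\<Sum>j<m. s (Suc j) * s j)
      = (\<Sum>j<m. (s (Suc (Suc j)) + s j) * s (Suc j))"
    by (simp add: sum.distrib[symmetric] algebra_simps)
  also have "\<dots> = 2 * cos \<theta> * (\<Sum>j<m. (s (Suc j))\<^sup>2)"
    by (simp add: rec sum_distrib_left power2_eq_square mult.assoc)
  finally have "(\<Sum>j\<in>{1..m}. (s (j mod m + 1) - s j)\<^sup>2)
      = 2 * (1 - cos \<theta>) * (\<Sum>j\<in>{1..m}. (s j)\<^sup>2)"
    unfolding shift by (simp add: algebra_simps)
  moreover have "s j = sin (pi * real j / real m)" for j
    by (simp add: s_def \<theta>_def mult.commute)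
  ultimately show ?thesis by (simp add: \<theta>_def)
qed

text \<open>Strictness comes from \<open>cos (x / 2) < 1\<close> in the half-angle formula.\<close>

lemma sin_less_self:
  fixes x :: real
  assumes "0 < x" "x < pi"
  shows "sin x < x"
proof -
  have "sin x = 2 * sin (x / 2) * cos (x / 2)"
    using sin_double[of "x / 2"] by simp
  also have "\<dots> < 2 * sin (x / 2) * cos 0"
    using assms by (intro mult_strict_left_mono cos_monotone_0_pi mult_pos_pos sin_gt_zero) auto
  also have "\<dots> \<le> x"
    using sin_x_le_x[of "x / 2"] assms by simp
  finally show ?thesis .
qed

text \<open>The left side is \<open>4 (sin (x / 2))^2\<close>. Its strict bound is carried through
  to the choice of the level, where it forces \<open>W\<close> to be nonempty.\<close>

lemma one_minus_cos_less:
  fixes x :: real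
  assumes "0 < x" "x < pi"
  shows "2 * (1 - cos x) < x\<^sup>2"
proof -
  have "(sin (x / 2))\<^sup>2 < (x / 2)\<^sup>2"
    using assms by (intro power_strict_mono sin_less_self sin_ge_zero) auto
  moreover have "cos x = 1 - 2 * (sin (x / 2))\<^sup>2"
    using cos_double_sin[of "x / 2"] by simp
  ultimately show ?thesis by (simp add: power_divide)
qed

lemma sine_prod_nonneg:
  assumes "x \<in> G1_verts m d"
  shows "0 \<le> sine_prod m d x"
  unfolding sine_prod_def
proof (rule prod_nonneg)
  fix i assume "i \<in> {1..d}"
  then have "x i \<in> {1..m}" using assms by (rule G1_verts_coord[rotated])
  then show "0 \<le> sin (pi * real (x i) / real m)"
    by (intro sin_ge_zero) (auto simp: field_simps)
qed

lemma sine_prod_eq_0: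
  assumes "m \<ge> 1" "k \<in> {1..d}" "x k = m"
  shows "sine_prod m d x = 0"
  using assms unfolding sine_prod_def by (intro prod_zero) (auto intro!: bexI[of _ k])

lemma sum_sine_prod_square:
  "(\<Sum>x\<in>G1_verts m d. (sine_prod m d x)\<^sup>2) = (\<Sum>j\<in>{1..m}. (sin (pi * real j / real m))\<^sup>2) ^ d"
proof -
  have "(\<Prod>i\<in>{1..d}. \<Sum>j\<in>{1..m}. (sin (pi * real j / real m))\<^sup>2)
      = (\<Sum>x\<in>G1_verts m d. \<Prod>i\<in>{1..d}. (sin (pi * real (x i) / real m))\<^sup>2)"
    unfolding G1_verts_def by (rule prod_sum_PiE) auto
  then show ?thesis by (simp add: sine_prod_def prod_power_distrib)
qed

lemma sum_sine_prod_square_pos: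
  assumes "m \<ge> 3"
  shows "0 < (\<Sum>x\<in>G1_verts m d. (sine_prod m d x)\<^sup>2)"
proof -
  have "0 < sin (pi * real 1 / real m)"
    using assms by (intro sin_gt_zero) (auto simp: field_simps)
  then have "0 < (\<Sum>j\<in>{1..m}. (sin (pi * real j / real m))\<^sup>2)"
    using assms by (intro sum_pos2[of _ 1]) auto
  then show ?thesis unfolding sum_sine_prod_square by simp
qed

text \<open>A step in direction \<open>k\<close> changes only the \<open>k\<close>-th factor, so the
  sum factorises into the one-dimensional energy and \<open>d - 1\<close> sums of squares.\<close>

lemma sum_sine_prod_energy:
  assumes "m \<ge> 1" "k \<in> {1..d}"
  shows "(\<Sum>x\<in>G1_verts m d. (sine_prod m d (up m k x) - sine_prod m d x)\<^sup>2)
    = 2 * (1 - cos (pi / real m)) * (\<Sum>x\<in>G1_verts m d. (sine_prod m d x)\<^sup>2)"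
proof -
  define s where "s = (\<lambda>j. sin (pi * real j / real m))"
  define q where "q = (\<lambda>i j. if i = k then (s (j mod m + 1) - s j)\<^sup>2 else (s j)\<^sup>2)"
  have split: "(\<Prod>i\<in>{1..d}. g i) = g k * (\<Prod>i\<in>{1..d} - {k}. g i)" for g :: "nat \<Rightarrow> real"
    using assms(2) by (intro prod.remove) auto
  have "(sine_prod m d (up m k x) - sine_prod m d x)\<^sup>2 = (\<Prod>i\<in>{1..d}. q i (x i))" for x
  proof -
    have "sine_prod m d (up m k x) - sine_prod m d x
        = (s (x k mod m + 1) - s (x k)) * (\<Prod>i\<in>{1..d} - {k}. s (x i))"
      unfolding sine_prod_def s_def split by (simp add: up_def left_diff_distrib)
    moreover have "(\<Prod>i\<in>{1..d} - {k}. q i (x i)) = (\<Prod>i\<in>{1..d} - {k}. s (x i))\<^sup>2"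
      unfolding prod_power_distrib by (intro prod.cong) (auto simp: q_def)
    ultimately show ?thesis
      unfolding split[of "\<lambda>i. q i (x i)"] by (simp add: q_def power_mult_distrib)
  qed
  then have "(\<Sum>x\<in>G1_verts m d. (sine_prod m d (up m k x) - sine_prod m d x)\<^sup>2)
      = (\<Sum>x\<in>G1_verts m d. \<Prod>i\<in>{1..d}. q i (x i))" by simp
  also have "\<dots> = (\<Prod>i\<in>{1..d}. \<Sum>j\<in>{1..m}. q i j)"
    unfolding G1_verts_def by (rule prod_sum_PiE[symmetric]) auto
  also have "\<dots> = (\<Sum>j\<in>{1..m}. q k j) * (\<Prod>i\<in>{1..d} - {k}. \<Sum>j\<in>{1..m}. (s j)\<^sup>2)"
    unfolding split by (intro arg_cong2[where f = "(*)"] prod.cong) (auto simp: q_def)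
  also have "(\<Sum>j\<in>{1..m}. q k j) = 2 * (1 - cos (pi / real m)) * (\<Sum>j\<in>{1..m}. (s j)\<^sup>2)"
    using sine_energy_one_dim[OF assms(1)] by (simp add: q_def s_def)
  also have "\<dots> * (\<Prod>i\<in>{1..d} - {k}. \<Sum>j\<in>{1..m}. (s j)\<^sup>2)
      = 2 * (1 - cos (pi / real m)) * (\<Prod>i\<in>{1..d}. \<Sum>j\<in>{1..m}. (s j)\<^sup>2)"
    unfolding split[of "\<lambda>i. \<Sum>j\<in>{1..m}. (s j)\<^sup>2"] by simp
  finally show ?thesis by (simp add: sum_sine_prod_square s_def)
qed

section \<open>Maxima over closed neighbourhoods\<close>

lemma finite_closed_nbhd: "finite (closed_nbhd m d x)"
  by (simp add: closed_nbhd_def)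

lemma sine_prod_le_sine_max: "y \<in> closed_nbhd m d x \<Longrightarrow> sine_prod m d y \<le> sine_max m d x"
  by (simp add: sine_max_def finite_closed_nbhd)

lemma sine_prod_le_sine_max_self: "sine_prod m d x \<le> sine_max m d x"
  by (rule sine_prod_le_sine_max) (simp add: closed_nbhd_def)

text \<open>The maximum is attained at a single vertex, so the increment is 0 or one of the positive
  parts on the right.\<close>

lemma sine_max_increment_square_le:
  fixes m d x
  defines "f \<equiv> sine_prod m d"
  shows "(sine_max m d x - f x)\<^sup>2 \<le>
    (\<Sum>k\<in>{1..d}. (max 0 (f (up m k x) - f x))\<^sup>2 + (max 0 (f (down m k x) - f x))\<^sup>2)"
    (is "_ \<le> (\<Sum>k\<in>_. ?a k)")
proof -
  have "sine_max m d x \<in> f ` closed_nbhd m d x"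
    unfolding sine_max_def f_def by (rule Max_in) (auto simp: closed_nbhd_def)
  then obtain y where y: "y \<in> closed_nbhd m d x" "sine_max m d x = f y" by blast
  have ge: "f x \<le> f y" using sine_prod_le_sine_max_self[of m d x] y by (simp add: f_def)
  have nn: "0 \<le> ?a k" for k by simp
  show ?thesis
  proof (cases "y = x")
    case True
    then show ?thesis using y nn by (simp add: sum_nonneg)
  next
    case False
    then obtain k where k: "k \<in> {1..d}" "y = up m k x \<or> y = down m k x"
      using y(1) by (auto simp: closed_nbhd_def)
    have "(sine_max m d x - f x)\<^sup>2 \<le> ?a k"
      using k(2) y(2) ge by (auto simp: max_def)
    also have "\<dots> \<le> (\<Sum>k\<in>{1..d}. ?a k)"
      using k(1) nn by (intro member_le_sum) auto
    finally show ?thesis .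
  qed
qed

text \<open>The maximum over a neighbourhood only sees increases of the function, so every edge is
  charged by at most one of its endpoints; hence the energy appears without a factor 2.\<close>

lemma sum_sine_max_increment_square_le:
  assumes "m \<ge> 1"
  shows "(\<Sum>x\<in>G1_verts m d. (sine_max m d x - sine_prod m d x)\<^sup>2)
    \<le> real d * (2 * (1 - cos (pi / real m))) * (\<Sum>x\<in>G1_verts m d. (sine_prod m d x)\<^sup>2)"
proof -
  let ?V = "G1_verts m d"
  define f where "f = sine_prod m d"
  have "(\<Sum>x\<in>?V. (sine_max m d x - f x)\<^sup>2) \<le>
    (\<Sum>x\<in>?V. \<Sum>k\<in>{1..d}. (max 0 (f (up m k x) - f x))\<^sup>2 + (max 0 (f (down m k x) - f x))\<^sup>2)"
    unfolding f_def by (intro sum_mono sine_max_increment_square_le)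
  also have "\<dots> = (\<Sum>k\<in>{1..d}. \<Sum>x\<in>?V. (max 0 (f (up m k x) - f x))\<^sup>2 + (max 0 (f (down m k x) - f x))\<^sup>2)"
    by (rule sum.swap)
  also have "\<dots> = (\<Sum>k\<in>{1..d}. \<Sum>x\<in>?V. (f (up m k x) - f x)\<^sup>2)"
  proof (rule sum.cong[OF refl])
    fix k assume k: "k \<in> {1..d}"
    \<comment> \<open>Reindexing along \<open>up m k\<close> brings the two one-sided terms of an
      edge to the same endpoint, where they add up to the full square.\<close>
    have "(\<Sum>x\<in>?V. (max 0 (f (down m k x) - f x))\<^sup>2) = (\<Sum>x\<in>?V. (max 0 (f x - f (up m k x)))\<^sup>2)"
      using k assms by (intro sum.reindex_bij_witness[of _ "up m k" "down m k"])
        (auto simp: up_down down_up up_mem down_mem)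
    moreover have "(max 0 (a - b))\<^sup>2 + (max 0 (b - a))\<^sup>2 = (a - b)\<^sup>2" for a b :: real
      by (cases "a \<le> b") (auto simp: max_def power2_commute)
    ultimately show "(\<Sum>x\<in>?V. (max 0 (f (up m k x) - f x))\<^sup>2 + (max 0 (f (down m k x) - f x))\<^sup>2)
      = (\<Sum>x\<in>?V. (f (up m k x) - f x)\<^sup>2)"
      unfolding sum.distrib by (simp flip: sum.distrib)
  qed
  also have "\<dots> = real d * (2 * (1 - cos (pi / real m))) * (\<Sum>x\<in>?V. (f x)\<^sup>2)"
    using sum_sine_prod_energy[OF assms] by (simp add: f_def)
  finally show ?thesis by (simp add: f_def)
qed

text \<open>The constant is the root of the product of two bounds: \<open>d (pi / m)^2 P\<close> for
  the squares of \<open>F - f\<close>, and \<open>4 P\<close> for those of \<open>F + f\<close>, as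
  \<open>f \<le> F\<close>.\<close>

lemma sum_sine_max_minus_less:
  assumes m: "m \<ge> 3" and d: "d \<ge> 1"
  shows "(\<Sum>x\<in>G1_verts m d. (sine_max m d x)\<^sup>2 - (sine_prod m d x)\<^sup>2)
    < 2 * pi * sqrt (real d) / real m * (\<Sum>x\<in>G1_verts m d. (sine_max m d x)\<^sup>2)"
proof -
  let ?V = "G1_verts m d"
  define f where "f = sine_prod m d"
  define F where "F = sine_max m d"
  define P where "P = (\<Sum>x\<in>?V. (F x)\<^sup>2)"
  define Q where "Q = (\<Sum>x\<in>?V. (f x)\<^sup>2)"
  have fF: "0 \<le> f x" "f x \<le> F x" if "x \<in> ?V" for x
    using that sine_prod_nonneg sine_prod_le_sine_max_self by (auto simp: f_def F_def)
  have Q: "0 < Q" using sum_sine_prod_square_pos[OF m] by (simp add: Q_def f_def)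
  have QP: "Q \<le> P" unfolding Q_def P_def using fF by (intro sum_mono power_mono) auto
  have cos: "2 * (1 - cos (pi / real m)) < (pi / real m)\<^sup>2"
    using m by (intro one_minus_cos_less) (auto simp: field_simps)
  have inc: "(\<Sum>x\<in>?V. (F x - f x)\<^sup>2) < real d * (pi / real m)\<^sup>2 * P"
  proof -
    have "(\<Sum>x\<in>?V. (F x - f x)\<^sup>2) \<le> real d * (2 * (1 - cos (pi / real m))) * Q"
      using sum_sine_max_increment_square_le[of m d] m by (simp add: f_def F_def Q_def)
    also have "\<dots> < real d * (pi / real m)\<^sup>2 * Q"
      using cos Q d by (intro mult_strict_right_mono mult_strict_left_mono) auto
    also have "\<dots> \<le> real d * (pi / real m)\<^sup>2 * P"
      using QP by (intro mult_left_mono) auto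
    finally show ?thesis .
  qed
  have plus: "(\<Sum>x\<in>?V. (F x + f x)\<^sup>2) \<le> 4 * P"
    unfolding P_def sum_distrib_left
  proof (rule sum_mono)
    fix x assume x: "x \<in> ?V"
    have "(F x + f x)\<^sup>2 \<le> (2 * F x)\<^sup>2" using fF[OF x] by (intro power_mono) auto
    then show "(F x + f x)\<^sup>2 \<le> 4 * (F x)\<^sup>2" by (simp add: power_mult_distrib)
  qed
  have "(\<Sum>x\<in>?V. (F x)\<^sup>2 - (f x)\<^sup>2)\<^sup>2 = (\<Sum>x\<in>?V. (F x - f x) * (F x + f x))\<^sup>2"
    by (simp add: power2_eq_square algebra_simps)
  also have "\<dots> \<le> (\<Sum>x\<in>?V. (F x - f x)\<^sup>2) * (\<Sum>x\<in>?V. (F x + f x)\<^sup>2)"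
    by (rule Cauchy_Schwarz_ineq_sum)
  also have "\<dots> \<le> (\<Sum>x\<in>?V. (F x - f x)\<^sup>2) * (4 * P)"
    using plus by (intro mult_left_mono sum_nonneg) auto
  also have "\<dots> < real d * (pi / real m)\<^sup>2 * P * (4 * P)"
    using inc Q QP by (intro mult_strict_right_mono) auto
  also have "\<dots> = (2 * pi * sqrt (real d) / real m * P)\<^sup>2"
    by (simp add: power_mult_distrib power_divide power2_eq_square[of P])
  finally have "(\<Sum>x\<in>?V. (F x)\<^sup>2 - (f x)\<^sup>2) < 2 * pi * sqrt (real d) / real m * P"
    using Q QP by (auto intro: power2_less_imp_less)
  then show ?thesis by (simp add: f_def F_def P_def)
qed

section \<open>The level sets and the spine\<close>

lemma exists_small_boundary_pair:
  assumes m: "m \<ge> 3" and d: "d \<ge> 1"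
  obtains U W where "W \<subseteq> G1_verts m d" "W \<noteq> {}"
    "real (card (W - U)) \<le> 2 * pi * sqrt (real d) / real m * real (card W)"
    "\<And>x y. x \<in> U \<Longrightarrow> G1_adj m d x y \<Longrightarrow> y \<in> W"
    "\<And>x k. x \<in> U \<Longrightarrow> k \<in> {1..d} \<Longrightarrow> x k \<noteq> m"
proof -
  let ?V = "G1_verts m d"
  let ?f = "sine_prod m d" and ?F = "sine_max m d"
  have fF: "0 \<le> (?f x)\<^sup>2 \<and> (?f x)\<^sup>2 \<le> (?F x)\<^sup>2" if "x \<in> ?V" for x
    using sine_prod_nonneg[OF that] sine_prod_le_sine_max_self[of m d x] by (simp add: power_mono)
  obtain t where t: "t \<ge> 0" "real (card {x \<in> ?V. t < (?F x)\<^sup>2 \<and> \<not> t < (?f x)\<^sup>2})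
      < 2 * pi * sqrt (real d) / real m * real (card {x \<in> ?V. t < (?F x)\<^sup>2})"
    using exists_level_small_boundary[OF finite_G1_verts fF sum_sine_max_minus_less[OF assms]] by blast
  define U where "U = {x \<in> ?V. t < (?f x)\<^sup>2}"
  define W where "W = {x \<in> ?V. t < (?F x)\<^sup>2}"
  show ?thesis
  proof
    show "W \<subseteq> ?V" by (auto simp: W_def)
    show "W \<noteq> {}"
    \<comment> \<open>The inequality at level \<open>t\<close> is strict, so an empty
      \<open>W\<close> would give \<open>0 < 0\<close>.\<close>
    proof
      assume "W = {}"
      then show False using t(2) unfolding W_def[symmetric] by simp
    qed
    have "W - U = {x \<in> ?V. t < (?F x)\<^sup>2 \<and> \<not> t < (?f x)\<^sup>2}" by (auto simp: U_def W_def)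
    then show "real (card (W - U)) \<le> 2 * pi * sqrt (real d) / real m * real (card W)"
      using t(2) by (simp add: W_def)
  next
    fix x y assume x: "x \<in> U" and adj: "G1_adj m d x y"
    then have "?f x \<le> ?F y" "0 \<le> ?f x" "y \<in> ?V"
      using sine_prod_le_sine_max[OF G1_adj_closed_nbhd[OF adj]] sine_prod_nonneg
      by (auto simp: U_def G1_adj_def)
    then have "(?f x)\<^sup>2 \<le> (?F y)\<^sup>2" by (intro power_mono)
    then show "y \<in> W" using x \<open>y \<in> ?V\<close> by (auto simp: U_def W_def)
  next
    fix x k assume "x \<in> U" "k \<in> {1..d}"
    \<comment> \<open>The sine product vanishes when a coordinate is \<open>m\<close>, and
      \<open>t \<ge> 0\<close> excludes its zeros from \<open>U\<close>.\<close>
    then show "x k \<noteq> m" using sine_prod_eq_0[of m k d x] m t(1) by (auto simp: U_def)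
  qed
qed

theorem theorem2:
  fixes m d :: nat
  assumes "m \<ge> 3" and "d \<ge> 1"
  shows "\<exists>S. vertex_spine m d S \<and>
    real (card S) \<le> 2 * pi * sqrt (real d) * real m ^ (d - 1)"
proof -
  let ?V = "G1_verts m d"
  define e where "e = 2 * pi * sqrt (real d) / real m"
  have m1: "m \<ge> 1" using assms by simp
  obtain U W where U: "W \<subseteq> ?V" "W \<noteq> {}" "real (card (W - U)) \<le> e * real (card W)"
    and nbhd: "\<And>x y. x \<in> U \<Longrightarrow> G1_adj m d x y \<Longrightarrow> y \<in> W"
    and avoid: "\<And>x k. x \<in> U \<Longrightarrow> k \<in> {1..d} \<Longrightarrow> x k \<noteq> m"
    using exists_small_boundary_pair[OF assms] unfolding e_def by metis
  define A where "A = (\<lambda>s. {x. shift m d s x \<in> U})"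
  define B where "B = (\<lambda>s. {x. shift m d s x \<in> W})"
  \<comment> \<open>Both counts are the same for every \<open>x\<close>, so the ratio for the pair
    \<open>U\<close>, \<open>W\<close> becomes the pointwise ratio needed for greedy
    deletion.\<close>
  have count: "card {s \<in> ?V. x \<in> B s} = card W" "card {s \<in> ?V. x \<in> B s - A s} = card (W - U)" for x
    using card_shift_preimage[OF m1, of W d x] card_shift_preimage[OF m1, of "W - U" d x] U
    by (auto simp: A_def B_def)
  have "\<exists>S\<subseteq>?V. real (card S) \<le> e * real (card ?V) \<and>
    (\<forall>c. graph_cycle ?V (G1_adj m d) c \<and> set c \<subseteq> ?V - S \<longrightarrow> (\<exists>s\<in>?V. set c \<subseteq> A s))"
  proof (rule exists_cycle_localizing_set[where B = B])
    fix x
    have "card W \<noteq> 0" using U(1,2) finite_subset[OF _ finite_G1_verts] by auto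
    then have "{s \<in> ?V. x \<in> B s} \<noteq> {}" using count(1)[of x] by (metis card.empty)
    then show "\<exists>s\<in>?V. x \<in> B s" by blast
    show "real (card {s \<in> ?V. x \<in> B s - A s}) \<le> e * real (card {s \<in> ?V. x \<in> B s})"
      unfolding count by (rule U(3))
  next
    fix s x y assume "x \<in> A s" "G1_adj m d x y"
    then show "y \<in> B s" using nbhd G1_adj_shift[OF m1] by (auto simp: A_def B_def)
  qed (rule finite_G1_verts)+
  then obtain S where S: "S \<subseteq> ?V" "real (card S) \<le> e * real (card ?V)"
    and loc: "\<And>c. graph_cycle ?V (G1_adj m d) c \<Longrightarrow> set c \<subseteq> ?V - S \<Longrightarrow> \<exists>s\<in>?V. set c \<subseteq> A s"
    by blast
  have "S \<inter> set c \<noteq> {}" if c: "nontrivial_cycle m d c" for c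
  proof
    assume "S \<inter> set c = {}"
    moreover have cyc: "graph_cycle ?V (G1_adj m d) c" using c by (simp add: nontrivial_cycle_def)
    ultimately obtain s where s: "set c \<subseteq> A s"
      using loc[OF cyc] by (auto simp: graph_cycle_def)
    obtain k where k: "k \<in> {1..d}" "{1..m} \<subseteq> (\<lambda>x. x k) ` set c"
      using c by (auto simp: nontrivial_cycle_def)
    \<comment> \<open>the value in coordinate \<open>k\<close> that the shift by \<open>s\<close> sends to \<open>m\<close>\<close>
    define j where "j = (m - 1 + (m - 1) * s k) mod m"
    \<comment> \<open>Residue 0 is represented by \<open>m\<close>, since coordinates range over
      \<open>{1..m}\<close>.\<close>
    define i where "i = (if j = 0 then m else j)"
    have "j < m" unfolding j_def using m1 by (intro mod_less_divisor) simp
    then have "i \<in> {1..m}" "i mod m = j" by (auto simp: i_def)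
    \<comment> \<open>Modulo \<open>m\<close> the factor \<open>m - 1\<close> acts as -1, so
      \<open>j\<close> is congruent to \<open>-1 - s k\<close> and \<open>i + s k\<close> to
      \<open>m - 1\<close>; the \<open>+ 1\<close> in \<open>shift\<close> then yields
      \<open>m\<close>.\<close>
    have "(i + s k) mod m = (j + s k) mod m"
      using \<open>i mod m = j\<close> by (metis mod_add_left_eq)
    also have "\<dots> = (m - 1 + m * s k) mod m"
    proof -
      have "(m - 1) * s k + s k = m * s k" using m1 by (cases m) auto
      then show ?thesis unfolding j_def mod_add_left_eq by (simp only: add.assoc)
    qed
    also have "\<dots> = m - 1" unfolding mod_mult_self2 using m1 by simp
    finally have im: "(i + s k) mod m + 1 = m" using m1 by simp
    obtain x where x: "x \<in> set c" "x k = i" using k(2) \<open>i \<in> {1..m}\<close> by auto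
    then have "shift m d s x k = m" using k(1) im by (simp add: shift_def)
    moreover have "shift m d s x \<in> U" using s x(1) by (auto simp: A_def)
    ultimately show False using avoid k(1) by blast
  qed
  then have "vertex_spine m d S" using S(1) by (simp add: vertex_spine_def)
  \<comment> \<open>The denominator of \<open>e\<close> cancels one of the \<open>d \<ge> 1\<close>
    factors of \<open>m ^ d\<close>.\<close>
  moreover have "e * real (card ?V) = 2 * pi * sqrt (real d) * real m ^ (d - 1)"
    using assms power_minus_mult[of d "real m"] by (simp add: e_def card_G1_verts field_simps)
  ultimately show ?thesis using S(2) by auto
qed

end
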